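(* The bound $\chi(G)\le 2\omega(G)$ for $\{P_3\cup P_2,\ \mathrm{gem}\}$-free graphs is tight for $\omega=2$ and $\omega=3$: there exists a $\{P_3\cup P_2,\ \mathrm{gem}\}$-free graph $G$ with $\omega(G)=2$ and $\chi(G)=4$, and there exists a $\{P_3\cup P_2,\ \mathrm{gem}\}$-free graph $G$ with $\omega(G)=3$ and $\chi(G)=6$.
   Context: All graphs are finite, simple and undirected. $\chi(G)$ is the chromatic number and $\omega(G)$ the clique number of $G$. $P_n$ is the path on $n$ vertices. $P_3\cup P_2$ is the disjoint union of $P_3$ and $P_2$. The gem is the join $K_1+P_4$ (a $P_4$ together with one extra vertex adjacent to all four vertices of the path). For a family $\mathcal{F}$ of graphs, $G$ is $\mathcal{F}$-free if no induced subgraph of $G$ is isomorphic to a member of $\mathcal{F}$. *)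

theory Defs
  imports "Graph_Theory.Digraph_Component" "Graph_Theory.Digraph_Isomorphism"
begin

text \<open>
  A finite simple undirected graph is a \<open>'a pair_pre_digraph\<close> satisfying \<open>pair_graph\<close>: finitely many
  vertices, no loops, and a symmetric arc relation, so that the undirected edge \<open>uv\<close> is represented
  by the two arcs \<open>(u, v)\<close> and \<open>(v, u)\<close>. \<open>with_proj\<close> embeds such a graph into the general
  digraphs on which \<open>induced_subgraph\<close> and \<open>digraph_iso\<close> are defined.
\<close>

definition is_clique :: "'a pair_pre_digraph \<Rightarrow> 'a set \<Rightarrow> bool" where
  "is_clique G K \<longleftrightarrow> K \<subseteq> pverts G \<and> (\<forall>u\<in>K. \<forall>v\<in>K. u \<noteq> v \<longrightarrow> (u, v) \<in> parcs G)"

definition clique_number :: "'a pair_pre_digraph \<Rightarrow> nat" where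
  "clique_number G = Max {card K | K. is_clique G K}"

definition proper_coloring :: "'a pair_pre_digraph \<Rightarrow> nat \<Rightarrow> ('a \<Rightarrow> nat) \<Rightarrow> bool" where
  "proper_coloring G k c \<longleftrightarrow>
     (\<forall>v\<in>pverts G. c v < k) \<and> (\<forall>(u, v)\<in>parcs G. c u \<noteq> c v)"

definition chromatic_number :: "'a pair_pre_digraph \<Rightarrow> nat" where
  "chromatic_number G = (LEAST k. \<exists>c. proper_coloring G k c)"

definition path_graph :: "nat \<Rightarrow> nat pair_pre_digraph" where
  "path_graph n =
     \<lparr> pverts = {..<n}, parcs = {(i, j). i < n \<and> j < n \<and> (j = Suc i \<or> i = Suc j)} \<rparr>"

definition complete_graph :: "nat \<Rightarrow> nat pair_pre_digraph" where
  "complete_graph n = \<lparr> pverts = {..<n}, parcs = {(i, j). i < n \<and> j < n \<and> i \<noteq> j} \<rparr>"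

definition disjoint_union ::
    "'a pair_pre_digraph \<Rightarrow> 'b pair_pre_digraph \<Rightarrow> ('a + 'b) pair_pre_digraph" where
  "disjoint_union G H =
     \<lparr> pverts = pverts G <+> pverts H,
       parcs = map_prod Inl Inl ` parcs G \<union> map_prod Inr Inr ` parcs H \<rparr>"

definition graph_join ::
    "'a pair_pre_digraph \<Rightarrow> 'b pair_pre_digraph \<Rightarrow> ('a + 'b) pair_pre_digraph" where
  "graph_join G H =
     \<lparr> pverts = pverts G <+> pverts H,
       parcs = parcs (disjoint_union G H) \<union>
         (Inl ` pverts G) \<times> (Inr ` pverts H) \<union> (Inr ` pverts H) \<times> (Inl ` pverts G) \<rparr>"

definition P3_union_P2 :: "(nat + nat) pair_pre_digraph" where
  "P3_union_P2 = disjoint_union (path_graph 3) (path_graph 2)"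

definition gem :: "(nat + nat) pair_pre_digraph" where
  "gem = graph_join (complete_graph 1) (path_graph 4)"

definition free_of :: "'b pair_pre_digraph set \<Rightarrow> 'a pair_pre_digraph \<Rightarrow> bool" where
  "free_of \<F> G \<longleftrightarrow>
     (\<nexists>K H. induced_subgraph K (with_proj G) \<and> H \<in> \<F> \<and> digraph_iso K (with_proj H))"

end

theory Submission
  imports Defs
begin

text \<open>
  Both graphs come from the 27 lines on a smooth cubic surface. The one with \<open>\<omega> = 3\<close> and
  \<open>\<chi> = 6\<close> is their intersection graph (the complement of the Schlaefli graph, which is the
  collinearity graph of the generalized quadrangle of order (2,4)). The one with \<open>\<omega> = 2\<close> and
  \<open>\<chi> = 4\<close> is the subgraph induced by the 16 lines that are skew to a given line (the 5-regular
  Clebsch graph).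

  Structure. Two intersecting lines span a tritangent plane, which contains one further line; no
  other line meets both of them, and each line outside the plane meets exactly one of
  the three. These properties, the assumptions of \<open>quadrangle\<close> below, give everything
  except the chromatic numbers. Two adjacent vertices have exactly one common neighbour, so there
  is no gem and no clique of size four. A vertex adjacent to neither end of an edge is adjacent to
  the third vertex \<open>z\<close> of its triangle; hence, if a \<open>P\<^sub>3\<close> had no edges to that edge, its middle
  vertex and \<open>z\<close> would be adjacent with two common neighbours, the ends of the \<open>P\<^sub>3\<close>.
  Every triangle contains a given vertex or a neighbour of it, so the other vertices
  induce a triangle-free graph (\<open>free_of_induced\<close>, \<open>clique_card_le_3\<close>, \<open>far_clique_card_le_2\<close>).

  The two chromatic numbers determine each other. The neighbourhood of a vertex \<open>v\<close> induces a
  perfect matching, so two new colours extend a colouring of the non-neighbours of \<open>v\<close> to the whole graph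
  (\<open>extend_far_coloring\<close>). It therefore suffices to give four colours for the small graph and
  to show that five are too few for the large one.

  Five colours are too few (\<open>no_five_coloring\<close>). As 27 > 25, six vertices
  \<open>a\<^sub>1, ..., a\<^sub>6\<close> get the same colour. Six pairwise skew lines are one half of a double-six: there are
  \<open>b\<^sub>1, ..., b\<^sub>6\<close> such that \<open>b\<^sub>i\<close> meets all the \<open>a\<^sub>j\<close> but \<open>a\<^sub>i\<close>. Each pair \<open>i \<noteq> j\<close>
  gives a line \<open>c\<^sub>i\<^sub>j\<close> meeting \<open>a\<^sub>i, a\<^sub>j, b\<^sub>i, b\<^sub>j\<close>, and \<open>c\<^sub>i\<^sub>j\<close> meets \<open>c\<^sub>k\<^sub>l\<close> when
  the pairs are disjoint. The lines \<open>b\<^sub>i\<close> and \<open>c\<^sub>i\<^sub>j\<close> share the other four colours. This colours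
  the edges of \<open>K\<^sub>6\<close> with four colours such that disjoint edges differ and every vertex misses a
  colour (that of \<open>b\<^sub>i\<close>), which is impossible (\<open>no_four_coloring_of_pairs\<close>).
\<close>

section \<open>Induced subgraphs, cliques and colourings\<close>

definition induced :: "'a pair_pre_digraph \<Rightarrow> 'a set \<Rightarrow> 'a pair_pre_digraph" where
  "induced G W = \<lparr> pverts = W, parcs = parcs G \<inter> W \<times> W \<rparr>"

lemma induced_simps [simp]:
  "pverts (induced G W) = W" "parcs (induced G W) = parcs G \<inter> W \<times> W"
  by (simp_all add: induced_def)

lemma (in pair_graph) adj_sym: "(u, v) \<in> parcs G \<Longrightarrow> (v, u) \<in> parcs G"
  using pair_sym_arcs by (auto simp: symmetric_def sym_def)

lemma (in pair_graph) adj_neq: "(u, v) \<in> parcs G \<Longrightarrow> u \<noteq> v"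
  using pair_no_loops by fastforce

lemma (in pair_graph) pair_graph_induced:
  assumes "W \<subseteq> pverts G"
  shows "pair_graph (induced G W)"
proof unfold_locales
  show "finite (pverts (induced G W))" "finite (parcs (induced G W))"
    using assms pair_finite_verts pair_finite_arcs by (auto intro: finite_subset)
  show "symmetric (with_proj (induced G W))"
    using adj_sym by (auto simp: symmetric_def sym_def)
qed (use adj_neq in auto)

text \<open>
  An isomorphism from an induced subgraph to \<open>H\<close> is inverted to an embedding of \<open>H\<close>, so that
  only adjacencies between named vertices of \<open>H\<close> have to be considered afterwards.
\<close>

lemma free_ofI:
  assumes "\<And>H f. \<lbrakk>H \<in> \<F>; inj_on f (pverts H); f ` pverts H \<subseteq> pverts G;
     \<forall>u\<in>pverts H. \<forall>v\<in>pverts H. (u, v) \<in> parcs H \<longleftrightarrow> (f u, f v) \<in> parcs G\<rbrakk> \<Longrightarrow> False"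
  shows "free_of \<F> G"
  unfolding free_of_def
proof (rule notI, elim exE conjE)
  fix K and H :: "'a pair_pre_digraph"
  assume ind: "induced_subgraph K (with_proj G)" and H: "H \<in> \<F>"
    and "digraph_iso K (with_proj H)"
  then obtain h where h: "pre_digraph.digraph_isomorphism K h" and HK: "with_proj H = app_iso h K"
    unfolding digraph_iso_def by blast
  define g where "g = iso_verts h"
  define f where "f = the_inv_into (verts K) g"
  have K: "verts K \<subseteq> pverts G" "tail K = fst" "head K = snd"
      "arcs K = {e \<in> parcs G. fst e \<in> verts K \<and> snd e \<in> verts K}"
    using ind by (auto simp: induced_subgraph_def subgraph_def compatible_def)
  have vH: "pverts H = g ` verts K"
    using arg_cong[OF HK, of verts] by (simp add: g_def)
  have aH: "parcs H = iso_arcs h ` arcs K"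
    using arg_cong[OF HK, of arcs] by simp
  have th: "iso_tail h = fst" "iso_head h = snd"
    using arg_cong[OF HK, of tail] arg_cong[OF HK, of head] by simp_all
  have inj: "inj_on g (verts K)"
    and ends: "\<And>e. e \<in> arcs K \<Longrightarrow> fst (iso_arcs h e) = g (fst e) \<and> snd (iso_arcs h e) = g (snd e)"
    using h K th by (auto simp: pre_digraph.digraph_isomorphism_def g_def)
  have fg: "f (g a) = a" if "a \<in> verts K" for a
    using that inj by (simp add: f_def the_inv_into_f_f)
  have adj: "(g a, g b) \<in> parcs H \<longleftrightarrow> (a, b) \<in> parcs G" if ab: "a \<in> verts K" "b \<in> verts K" for a b
  proof
    assume "(g a, g b) \<in> parcs H"
    then obtain e where e: "e \<in> arcs K" "iso_arcs h e = (g a, g b)"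
      using aH by auto
    then have "g (fst e) = g a" "g (snd e) = g b"
      using ends[of e] by auto
    then have "e = (a, b)"
      using e(1) ab K inj by (auto simp: inj_on_def prod_eq_iff)
    then show "(a, b) \<in> parcs G"
      using e K by auto
  next
    assume "(a, b) \<in> parcs G"
    then have "(a, b) \<in> arcs K"
      using ab K by auto
    then show "(g a, g b) \<in> parcs H"
      using ends[of "(a, b)"] aH by (metis fst_conv imageI prod.collapse snd_conv)
  qed
  show False
  proof (rule assms[OF H, of f])
    show "inj_on f (pverts H)"
      unfolding vH by (auto simp: inj_on_def fg)
    show "f ` pverts H \<subseteq> pverts G"
      unfolding vH using K by (auto simp: fg)
    show "\<forall>u\<in>pverts H. \<forall>v\<in>pverts H. (u, v) \<in> parcs H \<longleftrightarrow> (f u, f v) \<in> parcs G"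
      unfolding vH by (auto simp: fg adj)
  qed
qed

lemma clique_number_eqI:
  assumes K: "is_clique G K" "card K = n" and le: "\<And>L. is_clique G L \<Longrightarrow> card L \<le> n"
  shows "clique_number G = n"
  unfolding clique_number_def
proof (rule Max_eqI)
  have "{card L | L. is_clique G L} \<subseteq> {..n}"
    using le by blast
  then show "finite {card L | L. is_clique G L}"
    by (rule finite_subset) simp
  show "m \<le> n" if "m \<in> {card L | L. is_clique G L}" for m
    using that le by blast
  show "n \<in> {card L | L. is_clique G L}"
    using K by blast
qed

lemma chromatic_number_eqI:
  assumes "proper_coloring G (Suc k) c" "\<And>c. \<not> proper_coloring G k c"
  shows "chromatic_number G = Suc k"
  unfolding chromatic_number_def
proof (rule Least_equality)
  show "\<exists>c. proper_coloring G (Suc k) c"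
    using assms(1) by blast
  show "Suc k \<le> j" if j: "\<exists>c. proper_coloring G j c" for j
  proof (rule ccontr)
    assume "\<not> Suc k \<le> j"
    moreover obtain c where "proper_coloring G j c"
      using j by blast
    ultimately have "proper_coloring G k c"
      unfolding proper_coloring_def by (meson leD linorder_not_le not_less_eq_eq order_less_le_trans)
    with assms(2) show False
      by blast
  qed
qed

section \<open>Quadrangles with three points on a line\<close>

text \<open>
  The triangles are the lines of a (possibly degenerate) generalized quadrangle, and the adjacent vertices are the
  collinear points: two points lie on at most one line, all lines have three points, and each
  point off a line is collinear with a point of it (with only one, by the first assumption).
\<close>

locale quadrangle = pair_graph G for G :: "'a pair_pre_digraph" +
  assumes common_neighbour_unique: "\<lbrakk>(x, y) \<in> parcs G; (z, x) \<in> parcs G; (z, y) \<in> parcs G;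
      (w, x) \<in> parcs G; (w, y) \<in> parcs G\<rbrakk> \<Longrightarrow> z = w"
    and line: "(x, y) \<in> parcs G \<Longrightarrow> \<exists>z. (z, x) \<in> parcs G \<and> (z, y) \<in> parcs G \<and>
      (\<forall>w\<in>pverts G - {x, y, z}. (w, x) \<in> parcs G \<or> (w, y) \<in> parcs G \<or> (w, z) \<in> parcs G)"
begin

abbreviation adj (infix "\<sim>" 50) where "u \<sim> v \<equiv> (u, v) \<in> parcs G"

lemma third_point:
  assumes "x \<sim> y"
  obtains z where "z \<sim> x" "z \<sim> y"
  using line[OF assms] by blast

lemma projection:
  assumes xyz: "x \<sim> y" "z \<sim> x" "z \<sim> y" and w: "w \<in> pverts G" "w \<noteq> x" "w \<noteq> y" "w \<noteq> z"
    and "\<not> w \<sim> x" "\<not> w \<sim> y"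
  shows "w \<sim> z"
proof -
  obtain t where t: "t \<sim> x" "t \<sim> y" "\<forall>w\<in>pverts G - {x, y, t}. w \<sim> x \<or> w \<sim> y \<or> w \<sim> t"
    using line[OF xyz(1)] by blast
  then have "t = z"
    using common_neighbour_unique[OF xyz(1)] xyz by blast
  with t w assms(8,9) show ?thesis
    by blast
qed

text \<open>
  In a gem, the edge from the apex to an inner vertex of the path has two common neighbours.
  For \<open>P\<^sub>3 \<union> P\<^sub>2\<close>, all three vertices of the \<open>P\<^sub>3\<close> project to the third point \<open>z\<close> of the line
  through the \<open>P\<^sub>2\<close>; then the ends of the \<open>P\<^sub>3\<close> are common neighbours of \<open>z\<close> and its middle.
\<close>

lemma free_of_induced:
  assumes W: "W \<subseteq> pverts G"
  shows "free_of {P3_union_P2, gem} (induced G W)"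
proof (rule free_ofI)
  fix H :: "(nat + nat) pair_pre_digraph" and f
  assume H: "H \<in> {P3_union_P2, gem}" and inj: "inj_on f (pverts H)"
    and im: "f ` pverts H \<subseteq> pverts (induced G W)"
    and "\<forall>u\<in>pverts H. \<forall>v\<in>pverts H. (u, v) \<in> parcs H \<longleftrightarrow> (f u, f v) \<in> parcs (induced G W)"
  then have arcs: "(u, v) \<in> parcs H \<longleftrightarrow> f u \<sim> f v" if "u \<in> pverts H" "v \<in> pverts H" for u v
    using that by auto
  show False
  proof (cases "H = gem")
    case True
    have V: "Inl 0 \<in> pverts H" "Inr 0 \<in> pverts H" "Inr 1 \<in> pverts H" "Inr 2 \<in> pverts H"
      by (auto simp: True gem_def graph_join_def complete_graph_def path_graph_def)
    have "(Inl 0, Inr 1) \<in> parcs H" "(Inr 0, Inl 0) \<in> parcs H" "(Inr 0, Inr 1) \<in> parcs H"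
        "(Inr 2, Inl 0) \<in> parcs H" "(Inr 2, Inr 1) \<in> parcs H"
      by (auto simp: True gem_def graph_join_def disjoint_union_def complete_graph_def
          path_graph_def image_iff)
    then have "f (Inr 0) = f (Inr 2)"
      using V arcs common_neighbour_unique[of "f (Inl 0)" "f (Inr 1)"] by blast
    then show False
      using V inj by (auto dest: inj_onD)
  next
    case False
    then have H: "H = P3_union_P2"
      using H by blast
    have V: "Inl 0 \<in> pverts H" "Inl 1 \<in> pverts H" "Inl 2 \<in> pverts H"
        "Inr 0 \<in> pverts H" "Inr 1 \<in> pverts H"
      by (auto simp: H P3_union_P2_def disjoint_union_def path_graph_def)
    have E: "(Inl 0, Inl 1) \<in> parcs H" "(Inl 2, Inl 1) \<in> parcs H" "(Inr 0, Inr 1) \<in> parcs H"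
      by (auto simp: H P3_union_P2_def disjoint_union_def path_graph_def image_iff)
    have N: "(Inl i, Inr j) \<notin> parcs H" for i j
      by (auto simp: H P3_union_P2_def disjoint_union_def)
    have xy: "f (Inr 0) \<sim> f (Inr 1)"
      using arcs V E by blast
    then obtain z where z: "z \<sim> f (Inr 0)" "z \<sim> f (Inr 1)"
      by (rule third_point)
    have pz: "f (Inl i) \<sim> z" if i: "Inl i \<in> pverts H" for i
    proof -
      have "\<not> f (Inl i) \<sim> f (Inr 0)" "\<not> f (Inl i) \<sim> f (Inr 1)"
        using arcs i V N by blast+
      moreover have "f (Inl i) \<in> pverts G" "f (Inl i) \<noteq> f (Inr 0)" "f (Inl i) \<noteq> f (Inr 1)"
        using i V inj im W by (auto dest: inj_onD)
      moreover from calculation z have "f (Inl i) \<noteq> z"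
        by blast
      ultimately show ?thesis
        using projection[OF xy z] by blast
    qed
    have "f (Inl 0) = f (Inl 2)"
    proof (rule common_neighbour_unique)
      show "z \<sim> f (Inl 1)"
        using pz V adj_sym by blast
      show "f (Inl 0) \<sim> z" "f (Inl 2) \<sim> z"
        using pz V by blast+
      show "f (Inl 0) \<sim> f (Inl 1)" "f (Inl 2) \<sim> f (Inl 1)"
        using arcs V E by blast+
    qed
    then show False
      using V inj by (auto dest: inj_onD)
  qed
qed

lemma induced_all: "induced G (pverts G) = G"
  using wellformed' by (auto simp: induced_def intro!: pair_pre_digraph.equality)

lemma clique_subset_line:
  assumes "is_clique G K" "x \<in> K" "y \<in> K" "x \<sim> y" "z \<sim> x" "z \<sim> y"
  shows "K \<subseteq> {x, y, z}"
  using assms common_neighbour_unique[of x y _ z] unfolding is_clique_def by blast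

lemma clique_card_le_3:
  assumes K: "is_clique G K"
  shows "card K \<le> 3"
proof (cases "\<exists>x\<in>K. \<exists>y\<in>K. x \<noteq> y")
  case True
  then obtain x y where xy: "x \<in> K" "y \<in> K" "x \<sim> y"
    using K unfolding is_clique_def by blast
  obtain z where "z \<sim> x" "z \<sim> y"
    using third_point xy(3) by blast
  with clique_subset_line K xy have "K \<subseteq> {x, y, z}"
    by blast
  then have "card K \<le> card {x, y, z}"
    by (intro card_mono) auto
  also have "\<dots> \<le> 3"
    by (simp add: card_insert_if)
  finally show ?thesis .
next
  case False
  then have "card K \<le> 1"
    by (metis card_le_Suc0_iff_eq One_nat_def card.infinite le0)
  then show ?thesis
    by simp
qed

definition far :: "'a \<Rightarrow> 'a set" where
  "far v = {u \<in> pverts G. u \<noteq> v \<and> \<not> u \<sim> v}"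

text \<open>
  If a line of the quadrangle contains two points that are not collinear with \<open>v\<close>, then \<open>v\<close>
  is collinear with its third point, which is thus not in \<open>far v\<close>.
\<close>

lemma far_clique_card_le_2:
  assumes v: "v \<in> pverts G" and K: "is_clique (induced G (far v)) K"
  shows "card K \<le> 2"
proof (cases "\<exists>x\<in>K. \<exists>y\<in>K. x \<noteq> y")
  case True
  then obtain x y where xy: "x \<in> K" "y \<in> K" "x \<sim> y"
    using K unfolding is_clique_def by auto
  obtain z where z: "z \<sim> x" "z \<sim> y"
    using third_point xy(3) by blast
  have Kfar: "K \<subseteq> far v" and KG: "is_clique G K"
    using K unfolding is_clique_def far_def by auto
  have "v \<noteq> x" "v \<noteq> y" "\<not> v \<sim> x" "\<not> v \<sim> y"
    using Kfar xy adj_sym unfolding far_def by blast+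
  moreover from this z have "v \<noteq> z"
    by blast
  ultimately have "v \<sim> z"
    using projection[OF xy(3) z v] by blast
  then have "z \<notin> K"
    using Kfar adj_sym unfolding far_def by blast
  then have "K \<subseteq> {x, y}"
    using clique_subset_line[OF KG xy z] by blast
  then have "card K \<le> card {x, y}"
    by (intro card_mono) auto
  also have "\<dots> \<le> 2"
    by (simp add: card_insert_if)
  finally show ?thesis .
next
  case False
  then have "card K \<le> 1"
    by (metis card_le_Suc0_iff_eq One_nat_def card.infinite le0)
  then show ?thesis
    by simp
qed

text \<open>
  The neighbours of \<open>v\<close> induce a perfect matching, two on each line through \<open>v\<close>. The ranking \<open>r\<close>
  only serves to say which of the two gets the first of the new colours, and
  \<open>v\<close> itself may take any old colour.
\<close>

lemma extend_far_coloring: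
  fixes r :: "'a \<Rightarrow> nat"
  assumes r: "inj r" and v: "v \<in> pverts G" and k: "0 < k"
    and c: "proper_coloring (induced G (far v)) k c"
  shows "\<exists>c. proper_coloring G (k + 2) c"
proof -
  define d where "d u = (if u = v then 0 else if \<not> u \<sim> v then c u
      else if \<exists>z. z \<sim> v \<and> z \<sim> u \<and> r u < r z then k else Suc k)" for u
  have far: "c u < k" if "u \<in> pverts G" "u \<noteq> v" "\<not> u \<sim> v" for u
    using c that by (auto simp: proper_coloring_def far_def)
  have "d u < k + 2" if "u \<in> pverts G" for u
    using far[OF that] k by (auto simp: d_def)
  moreover have "d u \<noteq> d w" if uw: "u \<sim> w" for u w
  proof -
    have V: "u \<in> pverts G" "w \<in> pverts G" "u \<noteq> w" "w \<sim> u"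
      using uw wellformed' adj_neq adj_sym by blast+
    consider "u = v" | "w = v" | "u \<noteq> v" "w \<noteq> v" "\<not> u \<sim> v" "\<not> w \<sim> v"
      | "u \<noteq> v" "w \<noteq> v" "u \<sim> v" "\<not> w \<sim> v" | "u \<noteq> v" "w \<noteq> v" "\<not> u \<sim> v" "w \<sim> v"
      | "u \<noteq> v" "w \<noteq> v" "u \<sim> v" "w \<sim> v"
      by blast
    then show ?thesis
    proof cases
      case 3
      then have "c u \<noteq> c w"
        using c uw V by (auto simp: proper_coloring_def far_def)
      with 3 show ?thesis
        by (simp add: d_def)
    next
      case 6
      have "z = w" if "z \<sim> v" "z \<sim> u" for z
        using common_neighbour_unique[of u v z w] that 6 V by blast
      moreover have "z = u" if "z \<sim> v" "z \<sim> w" for z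
        using common_neighbour_unique[of w v z u] that 6 V uw by blast
      moreover have "r u \<noteq> r w"
        using r V by (auto dest: injD)
      ultimately have "(\<exists>z. z \<sim> v \<and> z \<sim> u \<and> r u < r z) \<longleftrightarrow> \<not> (\<exists>z. z \<sim> v \<and> z \<sim> w \<and> r w < r z)"
        using 6 V uw by (metis linorder_neqE_nat order_less_asym)
      with 6 show ?thesis
        by (auto simp: d_def)
    qed (use uw V far[of u] far[of w] k in \<open>auto simp: d_def\<close>)
  qed
  ultimately show ?thesis
    unfolding proper_coloring_def by blast
qed

end

section \<open>Pairs in a six-element set\<close>

lemma intersecting_pairs:
  assumes two: "\<And>e. e \<in> F \<Longrightarrow> card e = 2"
    and meet: "\<And>e e'. e \<in> F \<Longrightarrow> e' \<in> F \<Longrightarrow> e \<inter> e' \<noteq> {}"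
  shows "(\<exists>x. \<forall>e\<in>F. x \<in> e) \<or> (\<exists>T. card T = 3 \<and> (\<forall>e\<in>F. e \<subseteq> T))"
proof (cases "\<exists>x. \<forall>e\<in>F. x \<in> e")
  case False
  then obtain e0 where e0: "e0 \<in> F"
    by blast
  then obtain p q where pq: "e0 = {p, q}" "p \<noteq> q"
    using two by (metis card_2_iff)
  obtain e1 where e1: "e1 \<in> F" "p \<notin> e1"
    using False by blast
  then have "q \<in> e1"
    using meet[OF e0 e1(1)] pq by auto
  then obtain r where r: "e1 = {q, r}" "r \<noteq> q"
    using two[OF e1(1)] by (auto simp: card_2_iff)
  obtain e2 where e2: "e2 \<in> F" "q \<notin> e2"
    using False by blast
  have "p \<in> e2" "r \<in> e2"
    using meet[OF e0 e2(1)] meet[OF e1(1) e2(1)] pq r e2 by auto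
  then have e2': "e2 = {p, r}"
    using two[OF e2(1)] e1 r by (auto simp: card_2_iff)
  have pqr: "p \<noteq> q" "r \<noteq> p" "r \<noteq> q"
    using pq r e1 by auto
  then have "card {p, q, r} = 3"
    by simp
  moreover have "e \<subseteq> {p, q, r}" if e: "e \<in> F" for e
  proof -
    obtain a b where ab: "e = {a, b}"
      using two[OF e] by (auto simp: card_2_iff)
    show ?thesis
      using meet[OF e e0] meet[OF e e1(1)] meet[OF e e2(1)] pqr
      unfolding ab pq(1) r(1) e2' by blast
  qed
  ultimately show ?thesis
    by blast
qed simp

text \<open>
  Each colour class is a star or lies in a triangle. Let \<open>D\<close> be the set of star colours and remove
  the centres of these stars. At least \<open>6 - card D\<close> vertices remain, and the pairs of
  these are covered by \<open>4 - card D\<close> triangles. Counting pairs leaves two cases: four vertices and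
  two triangles, which do not suffice because a vertex outside one triangle has all its three
  pairs in the other; or three vertices, a triangle on them, and three stars with distinct centres.
  In the latter case a remaining vertex \<open>p\<close> sees all colours: the triangle colour, and
  on the pair of \<open>p\<close> with a centre the colour of that star. This contradicts the existence of \<open>f p\<close>.
\<close>

lemma no_four_coloring_of_pairs:
  fixes col :: "'a set \<Rightarrow> 'c" and f :: "'a \<Rightarrow> 'c"
  assumes S: "card S = 6" and K: "card K = 4"
    and colK: "\<And>e. e \<subseteq> S \<Longrightarrow> card e = 2 \<Longrightarrow> col e \<in> K" and fK: "\<And>v. v \<in> S \<Longrightarrow> f v \<in> K"
    and disj: "\<And>e e'. \<lbrakk>e \<subseteq> S; e' \<subseteq> S; card e = 2; card e' = 2; e \<inter> e' = {}\<rbrakk> \<Longrightarrow> col e \<noteq> col e'"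
    and miss: "\<And>v e. \<lbrakk>e \<subseteq> S; card e = 2; v \<in> e\<rbrakk> \<Longrightarrow> col e \<noteq> f v"
  shows False
proof -
  define F where "F k = {e. e \<subseteq> S \<and> card e = 2 \<and> col e = k}" for k
  define D where "D = {k \<in> K. \<exists>x. \<forall>e\<in>F k. x \<in> e}"
  have fin: "finite S" "finite K"
    using S K card.infinite by fastforce+
  then have finD: "finite D" "D \<subseteq> K"
    by (auto simp: D_def)
  have "\<forall>k\<in>D. \<exists>x. \<forall>e\<in>F k. x \<in> e"
    by (simp add: D_def)
  then have "\<exists>x. \<forall>k\<in>D. \<forall>e\<in>F k. x k \<in> e"
    by (rule bchoice)
  then obtain x where x: "\<And>k e. k \<in> D \<Longrightarrow> e \<in> F k \<Longrightarrow> x k \<in> e"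
    by blast
  have "\<forall>k\<in>K - D. \<exists>T. card T = 3 \<and> (\<forall>e\<in>F k. e \<subseteq> T)"
  proof
    fix k assume k: "k \<in> K - D"
    have "(\<exists>x. \<forall>e\<in>F k. x \<in> e) \<or> (\<exists>T. card T = 3 \<and> (\<forall>e\<in>F k. e \<subseteq> T))"
    proof (rule intersecting_pairs)
      show "card e = 2" if "e \<in> F k" for e
        using that by (simp add: F_def)
      show "e \<inter> e' \<noteq> {}" if "e \<in> F k" "e' \<in> F k" for e e'
        using disj[of e e'] that by (auto simp: F_def)
    qed
    with k show "\<exists>T. card T = 3 \<and> (\<forall>e\<in>F k. e \<subseteq> T)"
      unfolding D_def by blast
  qed
  then have "\<exists>T. \<forall>k\<in>K - D. card (T k) = 3 \<and> (\<forall>e\<in>F k. e \<subseteq> T k)"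
    by (rule bchoice)
  then obtain T where T: "\<And>k. k \<in> K - D \<Longrightarrow> card (T k) = 3"
      "\<And>k e. k \<in> K - D \<Longrightarrow> e \<in> F k \<Longrightarrow> e \<subseteq> T k"
    by blast
  define X where "X = x ` D"
  define R where "R = S - X"
  have finR: "finite R" "R \<subseteq> S"
    using fin by (auto simp: R_def)
  have cover: "col e \<in> K - D \<and> e \<subseteq> T (col e)" if e: "e \<subseteq> R" "card e = 2" for e
  proof -
    have eF: "e \<in> F (col e)" "col e \<in> K"
      using e finR colK by (auto simp: F_def)
    have "col e \<notin> D"
      using x[of "col e" e] eF e by (auto simp: R_def X_def)
    with eF T show ?thesis
      by blast
  qed
  have finT: "finite (T k)" if "k \<in> K - D" for k
    using T(1)[OF that] card.infinite by fastforce
  have cKD: "card (K - D) = 4 - card D"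
    using finD K by (simp add: card_Diff_subset)
  have "card R choose 2 = card {e. e \<subseteq> R \<and> card e = 2}"
    using finR by (simp add: n_subsets)
  also have "\<dots> \<le> card (\<Union>k\<in>K - D. {e. e \<subseteq> T k \<and> card e = 2})"
  proof (rule card_mono)
    show "finite (\<Union>k\<in>K - D. {e. e \<subseteq> T k \<and> card e = 2})"
      using fin finT by auto
  qed (use cover in blast)
  also have "\<dots> \<le> (\<Sum>k\<in>K - D. card {e. e \<subseteq> T k \<and> card e = 2})"
    using fin by (intro card_UN_le) auto
  also have "\<dots> = (\<Sum>k\<in>K - D. 3)"
    using T(1) finT by (intro sum.cong) (auto simp: n_subsets choose_two)
  also have "\<dots> = 3 * (4 - card D)"
    using cKD by simp
  finally have count: "card R * (card R - 1) div 2 \<le> 3 * (4 - card D)"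
    by (simp add: choose_two)
  have D4: "card D \<le> 4" and R6: "card R \<le> 6" and X: "card X \<le> card D" "6 \<le> card R + card X"
    using finD finR fin K S card_mono[of K D] card_mono[of S R] card_image_le[of D x]
      diff_card_le_card_Diff[of X S] by (auto simp: X_def R_def)
  have "card D \<in> {0,1,2,3,4}" "card R \<in> {0,1,2,3,4,5,6}"
    using D4 R6 by auto
  then consider "card D = 2" "card R = 4" | "card D = 3" "card R = 3"
    using count X by auto
  then show False
  proof cases
    case 1
    then obtain k1 k2 where k: "K - D = {k1, k2}"
      using cKD by (auto simp: card_2_iff)
    have "\<not> R \<subseteq> T k1"
      using card_mono[of "T k1" R] finT[of k1] T(1)[of k1] k 1 by auto
    then obtain p where p: "p \<in> R" "p \<notin> T k1"
      by blast
    have pq: "{p, q} \<subseteq> T k2" if "q \<in> R" "q \<noteq> p" for q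
      using cover[of "{p, q}"] p that k by auto
    have "R \<noteq> {p}"
      using 1 by auto
    then have "R \<subseteq> T k2"
      using pq p by blast
    then show False
      using card_mono[of "T k2" R] finT[of k2] T(1)[of k2] k 1 by auto
  next
    case 2
    then obtain k where k: "K - D = {k}"
      using cKD by (auto simp: card_1_singleton_iff)
    have other: "\<exists>q\<in>R. q \<noteq> p" for p
    proof (rule ccontr)
      assume "\<not> (\<exists>q\<in>R. q \<noteq> p)"
      then have "card R \<le> card {p}"
        by (intro card_mono) auto
      with 2 show False
        by simp
    qed
    have "R \<subseteq> T k"
    proof
      fix p assume p: "p \<in> R"
      then obtain q where "q \<in> R" "q \<noteq> p"
        using other by blast
      then show "p \<in> T k"
        using cover[of "{p, q}"] p k by auto
    qed
    then have RT: "R = T k"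
      using card_subset_eq[of "T k" R] finT[of k] T(1)[of k] k 2 by auto
    have cX: "card X = 3"
      using X 2 by simp
    then have injx: "inj_on x D"
      using 2 finD by (intro eq_card_imp_inj_on) (auto simp: X_def)
    have XS: "X \<subseteq> S"
    proof -
      have "card (S \<inter> X) = 3"
        using S 2 fin card_Diff_subset_Int[of S X] card_mono[of S "S \<inter> X"] by (auto simp: R_def)
      then have "S \<inter> X = X"
        using cX finD by (intro card_subset_eq) (auto simp: X_def)
      then show ?thesis
        by blast
    qed
    obtain p where p: "p \<in> R"
      using other by blast
    then have pS: "p \<in> S" "p \<notin> X"
      by (auto simp: R_def)
    show False
    proof (cases "f p = k")
      case True
      obtain q where "q \<in> R" "q \<noteq> p"
        using other by blast
      then show False
        using cover[of "{p, q}"] p k miss[of "{p, q}" p] finR True by auto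
    next
      case False
      then have d: "f p \<in> D"
        using fK[OF pS(1)] k by blast
      define e where "e = {p, x (f p)}"
      have xd: "x (f p) \<in> X"
        using d by (simp add: X_def)
      have "p \<noteq> x (f p)"
        using xd pS by metis
      then have e: "e \<subseteq> S" "card e = 2" "e \<in> F (col e)"
        using xd XS pS by (auto simp: e_def F_def)
      have ne: "col e \<noteq> f p"
        using miss[OF e(1,2), of p] by (simp add: e_def)
      show False
      proof (cases "col e \<in> D")
        case True
        then have "x (col e) \<in> e" "x (col e) \<in> X"
          using x e by (auto simp: X_def)
        then have "x (col e) = x (f p)"
          using pS by (auto simp: e_def)
        then show False
          using injx True d ne by (auto dest: inj_onD)
      next
        case False
        then have "col e \<in> K - D"
          using colK[OF e(1,2)] by blast
        then have "e \<subseteq> T k"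
          using T(2)[OF _ e(3)] k by auto
        then show False
          using RT xd by (auto simp: e_def R_def)
      qed
    qed
  qed
qed

section \<open>Double-sixes and five colours\<close>

text \<open>
  The additional assumption says that six pairwise non-collinear points are one half of a
  double-six, whose other half consists of the points \<open>w\<close>.
\<close>

locale double_six_quadrangle = quadrangle +
  assumes partner: "\<lbrakk>S \<subseteq> pverts G; card S = 6; \<forall>u\<in>S. \<forall>v\<in>S. \<not> u \<sim> v; v \<in> S\<rbrakk> \<Longrightarrow>
    \<exists>w\<in>pverts G. \<not> w \<sim> v \<and> (\<forall>u\<in>S - {v}. w \<sim> u)"
begin

text \<open>
  In terms of a double-six \<open>a\<^sub>i, b\<^sub>i\<close> and the points \<open>c\<^sub>i\<^sub>j\<close>, the set \<open>S\<close> in the proof consists of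
  the \<open>a\<^sub>i\<close>, the function \<open>w\<close> maps \<open>a\<^sub>i\<close> to \<open>b\<^sub>i\<close>, and \<open>P\<close> maps \<open>{a\<^sub>i, a\<^sub>j}\<close> to \<open>c\<^sub>i\<^sub>j\<close>.
\<close>

lemma no_five_coloring:
  assumes V: "25 < card (pverts G)"
  shows "\<not> proper_coloring G 5 c"
proof
  assume c: "proper_coloring G 5 c"
  have "\<exists>a<5. 5 < card {v \<in> pverts G. c v = a}"
  proof (rule ccontr)
    assume *: "\<not> ?thesis"
    have "pverts G = (\<Union>a<5. {v \<in> pverts G. c v = a})"
      using c by (auto simp: proper_coloring_def)
    then have "card (pverts G) = card (\<Union>a<5. {v \<in> pverts G. c v = a})"
      by simp
    also have "\<dots> \<le> (\<Sum>a<5. card {v \<in> pverts G. c v = a})"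
      by (rule card_UN_le) simp
    also have "\<dots> \<le> (\<Sum>a<(5::nat). 5)"
      using * by (intro sum_mono) (metis lessThan_iff not_less)
    finally show False
      using V by simp
  qed
  then obtain a where a: "a < 5" "6 \<le> card {v \<in> pverts G. c v = a}"
    by auto
  then obtain S where S: "S \<subseteq> {v \<in> pverts G. c v = a}" "card S = 6"
    by (metis obtain_subset_with_card_n)
  have proper: "c u \<noteq> c v" if "u \<sim> v" for u v
    using c that by (auto simp: proper_coloring_def)
  have SV: "u \<in> pverts G" if "u \<in> S" for u
    using S that by blast
  have ind: "\<not> u \<sim> v" if "u \<in> S" "v \<in> S" for u v
  proof -
    have "c u = c v"
      using S that by blast
    then show ?thesis
      using proper by blast
  qed
  have "\<forall>v\<in>S. \<exists>w. w \<in> pverts G \<and> \<not> w \<sim> v \<and> (\<forall>u\<in>S - {v}. w \<sim> u)"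
  proof
    fix v assume "v \<in> S"
    then have "\<exists>w\<in>pverts G. \<not> w \<sim> v \<and> (\<forall>u\<in>S - {v}. w \<sim> u)"
      using S SV ind by (intro partner) auto
    then show "\<exists>w. w \<in> pverts G \<and> \<not> w \<sim> v \<and> (\<forall>u\<in>S - {v}. w \<sim> u)"
      by blast
  qed
  then have "\<exists>w. \<forall>v\<in>S. w v \<in> pverts G \<and> \<not> w v \<sim> v \<and> (\<forall>u\<in>S - {v}. w v \<sim> u)"
    by (rule bchoice)
  then obtain w where w: "\<And>v. v \<in> S \<Longrightarrow> w v \<in> pverts G" "\<And>v. v \<in> S \<Longrightarrow> \<not> w v \<sim> v"
      "\<And>u v. v \<in> S \<Longrightarrow> u \<in> S \<Longrightarrow> u \<noteq> v \<Longrightarrow> w v \<sim> u"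
    by blast
  have wS: "w v \<noteq> u" if uv: "u \<in> S" "v \<in> S" for u v
  proof -
    have "S \<noteq> {v}"
      using S by auto
    then obtain t where "t \<in> S" "t \<noteq> v"
      using uv by blast
    then show ?thesis
      using w(3)[of v t] ind[of u t] uv by blast
  qed
  have ww: "w u \<noteq> w v" "\<not> w u \<sim> w v" if uv: "u \<in> S" "v \<in> S" "u \<noteq> v" for u v
  proof -
    show "w u \<noteq> w v"
      using w uv by metis
    have "2 \<le> card (S - {u, v})"
      using S uv by (subst card_Diff_subset) auto
    then obtain B where "B \<subseteq> S - {u, v}" "card B = 2"
      by (rule obtain_subset_with_card_n)
    then obtain s t where st: "s \<in> S" "s \<noteq> u" "s \<noteq> v" "t \<in> S" "t \<noteq> u" "t \<noteq> v" "s \<noteq> t"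
      by (auto simp: card_2_iff)
    then have "s \<sim> w u" "s \<sim> w v" "t \<sim> w u" "t \<sim> w v"
      using w(3) uv adj_sym by blast+
    then show "\<not> w u \<sim> w v"
      using common_neighbour_unique[of "w u" "w v" s t] st by blast
  qed
  \<comment> \<open>The third point \<open>p\<close> of the line through \<open>u\<close> and \<open>w v\<close> is also on the line through \<open>v\<close>
      and \<open>w u\<close>, because neither \<open>v\<close> nor \<open>w u\<close> is collinear with \<open>u\<close> or \<open>w v\<close>.\<close>
  have "\<exists>p. \<forall>u\<in>e. p \<sim> u \<and> p \<sim> w u" if e: "e \<subseteq> S" "card e = 2" for e
  proof -
    obtain u v where uv: "e = {u, v}" "u \<noteq> v"
      using e by (auto simp: card_2_iff)
    then have S2: "u \<in> S" "v \<in> S"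
      using e by auto
    have l: "u \<sim> w v"
      using w(3) S2 uv adj_sym by blast
    then obtain p where p: "p \<sim> u" "p \<sim> w v"
      by (rule third_point)
    have "v \<sim> p"
    proof (rule projection[OF l p])
      show "v \<noteq> p" using p ind S2 by blast
      show "\<not> v \<sim> u" "\<not> v \<sim> w v" using ind S2 w(2) adj_sym by blast+
      show "v \<in> pverts G" "v \<noteq> u" "v \<noteq> w v" using S2 SV wS uv by metis+
    qed
    have "w u \<sim> p"
    proof (rule projection[OF l p])
      show "w u \<noteq> p" using p w(2) S2 by blast
      show "w u \<noteq> u" using wS S2 by blast
      show "w u \<noteq> w v" using ww S2 uv by blast
      show "\<not> w u \<sim> u" "\<not> w u \<sim> w v" "w u \<in> pverts G" using w ww S2 uv by blast+
    qed
    with p \<open>v \<sim> p\<close> uv adj_sym show ?thesis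
      by blast
  qed
  then have "\<exists>P. \<forall>e\<in>{e. e \<subseteq> S \<and> card e = 2}. \<forall>u\<in>e. P e \<sim> u \<and> P e \<sim> w u"
    by (intro bchoice) blast
  then obtain P where P: "\<And>e u. e \<subseteq> S \<Longrightarrow> card e = 2 \<Longrightarrow> u \<in> e \<Longrightarrow> P e \<sim> u \<and> P e \<sim> w u"
    by blast
  have off: "\<not> P e \<sim> x \<and> \<not> P e \<sim> w x" if e: "e \<subseteq> S" "card e = 2" and x: "x \<in> S" "x \<notin> e" for e x
  proof -
    obtain u v where uv: "e = {u, v}" "u \<noteq> v"
      using e by (auto simp: card_2_iff)
    then have *: "u \<in> S" "v \<in> S" "x \<noteq> u" "x \<noteq> v"
      using e x by auto
    have l: "u \<sim> w v" "P e \<sim> u" "P e \<sim> w v" "P e \<sim> v" "P e \<sim> w u"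
      using w(3) * uv adj_sym P[OF e] by blast+
    have "\<not> P e \<sim> x"
      using common_neighbour_unique[of "w v" "P e" x u] w(3) adj_sym l * x by blast
    moreover have "\<not> P e \<sim> w x"
      using common_neighbour_unique[of u "P e" "w x" "w v"] w(3) ww(1) adj_sym l * x by blast
    ultimately show ?thesis
      by blast
  qed
  have disj: "P e \<sim> P e'"
    if e: "e \<subseteq> S" "card e = 2" and e': "e' \<subseteq> S" "card e' = 2" and "e \<inter> e' = {}" for e e'
  proof -
    obtain x y where xy: "e' = {x, y}" "x \<noteq> y"
      using e' by (auto simp: card_2_iff)
    then have *: "x \<in> S" "y \<in> S" "x \<notin> e" "y \<notin> e"
      using e' that by auto
    have l: "x \<sim> w y" "P e' \<sim> x" "P e' \<sim> w y"
      using w(3) * xy adj_sym P[OF e'] by blast+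
    obtain u where u: "u \<in> e"
      using e by (auto simp: card_2_iff)
    have n: "\<not> P e \<sim> x" "\<not> P e \<sim> w y"
      using off[OF e] * by blast+
    have Pu: "P e \<sim> u" "P e \<sim> w u"
      using P[OF e u] by blast+
    have us: "u \<in> S" "y \<noteq> u"
      using u e * by blast+
    show ?thesis
    proof (rule projection[OF l _ _ _ _ n])
      show "P e \<in> pverts G" using Pu wellformed' by blast
      show "P e \<noteq> x" using Pu(1) ind[of x u] us * by metis
      show "P e \<noteq> w y" using Pu(2) ww(2)[of y u] us * by metis
      show "P e \<noteq> P e'" using l n by metis
    qed
  qed
  have lt: "c u < 5" if "u \<in> pverts G" for u
    using c that by (auto simp: proper_coloring_def)
  have ca: "c u = a" if "u \<in> S" for u
    using S that by blast
  show False
  proof (rule no_four_coloring_of_pairs[of S "{..<5} - {a}" "\<lambda>e. c (P e)" "\<lambda>v. c (w v)"])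
    show "card S = 6" by (fact S)
    show "card ({..<5} - {a}) = 4" using a by simp
    show "c (P e) \<in> {..<5} - {a}" if e: "e \<subseteq> S" "card e = 2" for e
    proof -
      obtain u where u: "u \<in> e"
        using e by (auto simp: card_2_iff)
      then have "P e \<sim> u" "u \<in> S"
        using P[OF e] e by blast+
      then show ?thesis
        using proper ca lt wellformed' by fastforce
    qed
    show "c (w v) \<in> {..<5} - {a}" if v: "v \<in> S" for v
    proof -
      have "S \<noteq> {v}" using S by auto
      then obtain u where "u \<in> S" "u \<noteq> v" using v by blast
      then show ?thesis
        using proper[OF w(3)[OF v]] ca lt w(1)[OF v] by fastforce
    qed
    show "c (P e) \<noteq> c (P e')"
      if "e \<subseteq> S" "e' \<subseteq> S" "card e = 2" "card e' = 2" "e \<inter> e' = {}" for e e'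
      using disj proper that by blast
    show "c (P e) \<noteq> c (w v)" if "e \<subseteq> S" "card e = 2" "v \<in> e" for e v
      using P proper that by blast
  qed
qed

end

section \<open>The 27 lines\<close>

text \<open>
  The labels use Schlaefli's notation for a double-six, with \<open>a\<^sub>i\<close> encoded by the number \<open>i\<close>, \<open>b\<^sub>i\<close> by
  \<open>10 * i\<close> and, for \<open>i < j\<close>, \<open>c\<^sub>i\<^sub>j\<close> by \<open>10 * i + j\<close>.
\<close>

definition cubic_lines :: "nat list" where
  "cubic_lines = [1,2,3,4,5,6, 10,20,30,40,50,60, 12,13,14,15,16,23,24,25,26,34,35,36,45,46,56]"

text \<open>
  The 30 tritangent planes \<open>a\<^sub>i b\<^sub>j c\<^sub>i\<^sub>j\<close>, followed by the 15 planes \<open>c\<^sub>i\<^sub>j c\<^sub>k\<^sub>l c\<^sub>m\<^sub>n\<close>.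
\<close>

definition tritangent :: "nat list list" where
  "tritangent =
    [[1,20,12],[2,10,12],[1,30,13],[3,10,13],[1,40,14],[4,10,14],[1,50,15],[5,10,15],
     [1,60,16],[6,10,16],[2,30,23],[3,20,23],[2,40,24],[4,20,24],[2,50,25],[5,20,25],
     [2,60,26],[6,20,26],[3,40,34],[4,30,34],[3,50,35],[5,30,35],[3,60,36],[6,30,36],
     [4,50,45],[5,40,45],[4,60,46],[6,40,46],[5,60,56],[6,50,56],
     [12,34,56],[12,35,46],[12,36,45],[13,24,56],[13,25,46],[13,26,45],[14,23,56],[14,25,36],
     [14,26,35],[15,23,46],[15,24,36],[15,26,34],[16,23,45],[16,24,35],[16,25,34]]"

definition meets :: "nat \<Rightarrow> nat \<Rightarrow> bool" where
  "meets u v \<longleftrightarrow> u \<noteq> v \<and> (\<exists>L\<in>set tritangent. u \<in> set L \<and> v \<in> set L)"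

definition meeting :: "nat \<Rightarrow> nat list" where
  "meeting u = concat (map (removeAll u) (filter (\<lambda>L. u \<in> set L) tritangent))"

lemma meets_meeting: "meets u v \<longleftrightarrow> v \<in> set (meeting u)"
  by (auto simp: meets_def meeting_def)

lemma meeting_simps:
 "meeting 1 = [20, 12, 30, 13, 40, 14, 50, 15, 60, 16]"
 "meeting 2 = [10, 12, 30, 23, 40, 24, 50, 25, 60, 26]"
 "meeting 3 = [10, 13, 20, 23, 40, 34, 50, 35, 60, 36]"
 "meeting 4 = [10, 14, 20, 24, 30, 34, 50, 45, 60, 46]"
 "meeting 5 = [10, 15, 20, 25, 30, 35, 40, 45, 60, 56]"
 "meeting 6 = [10, 16, 20, 26, 30, 36, 40, 46, 50, 56]"
 "meeting 10 = [2, 12, 3, 13, 4, 14, 5, 15, 6, 16]"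
 "meeting 20 = [1, 12, 3, 23, 4, 24, 5, 25, 6, 26]"
 "meeting 30 = [1, 13, 2, 23, 4, 34, 5, 35, 6, 36]"
 "meeting 40 = [1, 14, 2, 24, 3, 34, 5, 45, 6, 46]"
 "meeting 50 = [1, 15, 2, 25, 3, 35, 4, 45, 6, 56]"
 "meeting 60 = [1, 16, 2, 26, 3, 36, 4, 46, 5, 56]"
 "meeting 12 = [1, 20, 2, 10, 34, 56, 35, 46, 36, 45]"
 "meeting 13 = [1, 30, 3, 10, 24, 56, 25, 46, 26, 45]"
 "meeting 14 = [1, 40, 4, 10, 23, 56, 25, 36, 26, 35]"
 "meeting 15 = [1, 50, 5, 10, 23, 46, 24, 36, 26, 34]"
 "meeting 16 = [1, 60, 6, 10, 23, 45, 24, 35, 25, 34]"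
 "meeting 23 = [2, 30, 3, 20, 14, 56, 15, 46, 16, 45]"
 "meeting 24 = [2, 40, 4, 20, 13, 56, 15, 36, 16, 35]"
 "meeting 25 = [2, 50, 5, 20, 13, 46, 14, 36, 16, 34]"
 "meeting 26 = [2, 60, 6, 20, 13, 45, 14, 35, 15, 34]"
 "meeting 34 = [3, 40, 4, 30, 12, 56, 15, 26, 16, 25]"
 "meeting 35 = [3, 50, 5, 30, 12, 46, 14, 26, 16, 24]"
 "meeting 36 = [3, 60, 6, 30, 12, 45, 14, 25, 15, 24]"
 "meeting 45 = [4, 50, 5, 40, 12, 36, 13, 26, 16, 23]"
 "meeting 46 = [4, 60, 6, 40, 12, 35, 13, 25, 15, 23]"
 "meeting 56 = [5, 60, 6, 50, 12, 34, 13, 24, 14, 23]"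
  by (simp_all add: meeting_def tritangent_def del: One_nat_def)



text \<open>
  The search adds the vertices in the order of the list \<open>xs\<close>, so that each independent set of
  size \<open>k\<close> in it is visited once, and tests \<open>P\<close> on the union of \<open>S\<close> with each of them.
\<close>

fun all_cocliques :: "('a \<Rightarrow> 'a \<Rightarrow> bool) \<Rightarrow> ('a list \<Rightarrow> bool) \<Rightarrow> nat \<Rightarrow> 'a list \<Rightarrow> 'a list \<Rightarrow> bool"
where
  "all_cocliques E P 0 S xs = P S"
| "all_cocliques E P (Suc k) S [] = True"
| "all_cocliques E P (Suc k) S (x # xs) \<longleftrightarrow>
     all_cocliques E P k (x # S) (filter (\<lambda>y. \<not> E x y) xs) \<and> all_cocliques E P (Suc k) S xs"

lemma all_cocliquesD:
  assumes "all_cocliques E P k S xs" "A \<subseteq> set xs" "card A = k" "\<forall>x\<in>A. \<forall>y\<in>A. \<not> E x y"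
  shows "\<exists>ys. set ys = set S \<union> A \<and> P ys"
  using assms
proof (induction E P k S xs arbitrary: A rule: all_cocliques.induct)
  case (1 E P S xs)
  then have "A = {}"
    by (auto dest: finite_subset)
  with 1 show ?case
    by auto
next
  case (2 E P k S)
  then show ?case
    by simp
next
  case (3 E P k S x xs)
  show ?case
  proof (cases "x \<in> A")
    case True
    have "\<exists>ys. set ys = set (x # S) \<union> (A - {x}) \<and> P ys"
    proof (rule 3(1))
      show "all_cocliques E P k (x # S) (filter (\<lambda>y. \<not> E x y) xs)"
        using 3(3) by simp
      show "A - {x} \<subseteq> set (filter (\<lambda>y. \<not> E x y) xs)"
        using 3(4,6) True by auto
      show "card (A - {x}) = k"
        using 3(5) True by simp
    qed (use 3(6) in blast)
    moreover have "set (x # S) \<union> (A - {x}) = set S \<union> A"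
      using True by auto
    ultimately show ?thesis
      by simp
  next
    case False
    show ?thesis
    proof (rule 3(2))
      show "all_cocliques E P (Suc k) S xs"
        using 3(3) by simp
      show "A \<subseteq> set xs"
        using 3(4) False by auto
    qed (use 3(5,6) in auto)
  qed
qed

text \<open>
  The test asks each member \<open>v\<close> of a six for its partner in the double-six. The filters
  are nested such that each one scans the few candidates that the previous ones left.
\<close>

definition partner_check :: "nat list \<Rightarrow> bool" where
  "partner_check S \<longleftrightarrow> list_all (\<lambda>v. filter (\<lambda>w. \<not> meets v w)
     (fold (\<lambda>u. filter (meets u)) (removeAll v S) cubic_lines) \<noteq> []) S"

text \<open>
  Rewriting with these rules alone evaluates the tests below on numerals. The congruence rule for
  conditionals is essential: without it, both branches of every filter step are evaluated.
\<close>

lemmas evaluate =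
  list.set list.pred_inject insert_iff empty_iff append.simps filter.simps meeting_simps meets_meeting
  numeral_eq_iff num.inject num.distinct one_eq_numeral_iff numeral_eq_one_iff
  simp_thms if_True if_False

text \<open>
  There are 72 sixes of pairwise skew lines, and each of them has the expected partners.
\<close>

lemma double_six_check: "all_cocliques meets partner_check 6 [] cubic_lines"
proof -
  have "(6::nat) = Suc (Suc (Suc (Suc (Suc (Suc 0)))))"
    by simp
  then show ?thesis
    by (rule ssubst) (simp only: cubic_lines_def evaluate all_cocliques.simps partner_check_def
        fold_simps removeAll.simps list.distinct cong: if_weak_cong)
qed

lemma triple_check:
  "list_all (\<lambda>L. list_all (\<lambda>w. w \<in> set L \<or> length (filter (meets w) L) = Suc 0) cubic_lines) tritangent"
  by (simp only: cubic_lines_def tritangent_def evaluate list.size add_0 add_Suc_right cong: if_weak_cong)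

lemma tritangentD:
  assumes "L \<in> set tritangent"
  shows "card (set L) = 3" "set L \<subseteq> set cubic_lines"
proof -
  have "list_all (\<lambda>L. length L = 3 \<and> distinct L \<and> set L \<subseteq> set cubic_lines) tritangent"
    by (simp add: tritangent_def cubic_lines_def)
  with assms have "length L = 3" "distinct L" and sub: "set L \<subseteq> set cubic_lines"
    by (auto simp: list_all_iff)
  then show "card (set L) = 3"
    by (simp add: distinct_card)
  show "set L \<subseteq> set cubic_lines"
    by (fact sub)
qed

lemma meets_one_of_triple:
  assumes "L \<in> set tritangent" "w \<in> set cubic_lines" "w \<notin> set L"
  shows "\<exists>x. {u \<in> set L. meets w u} = {x}"
proof -
  have "length (filter (meets w) L) = 1"
    using triple_check assms by (auto simp: list_all_iff)
  then obtain x where "filter (meets w) L = [x]"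
    by (auto simp: length_Suc_conv)
  then show ?thesis
    by (metis list.set(1,2) set_filter)
qed

definition cubic_graph :: "nat pair_pre_digraph" where
  "cubic_graph = \<lparr> pverts = set cubic_lines, parcs = {(u, v). meets u v} \<rparr>"

lemma cubic_graph_simps [simp]:
  "pverts cubic_graph = set cubic_lines" "(u, v) \<in> parcs cubic_graph \<longleftrightarrow> meets u v"
  by (simp_all add: cubic_graph_def)

lemma meets_sym: "meets u v \<longleftrightarrow> meets v u"
  by (auto simp: meets_def)

lemma meets_irrefl: "\<not> meets u u"
  by (simp add: meets_def)

lemma meets_cubic_lines: "meets u v \<Longrightarrow> u \<in> set cubic_lines \<and> v \<in> set cubic_lines"
  unfolding meets_def using tritangentD(2) by blast

lemma pair_graph_cubic_graph: "pair_graph cubic_graph"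
proof unfold_locales
  have "parcs cubic_graph \<subseteq> set cubic_lines \<times> set cubic_lines"
    using meets_cubic_lines by (auto simp: cubic_graph_def)
  then show "finite (parcs cubic_graph)"
    by (rule finite_subset) simp
  show "symmetric (with_proj cubic_graph)"
    using meets_sym by (auto simp: symmetric_def sym_def)
qed (use meets_cubic_lines meets_irrefl in auto)

lemma set_fold_filter:
  "set (fold (\<lambda>u. filter (E u)) us xs) = {x \<in> set xs. \<forall>u\<in>set us. E u x}"
  by (induction us arbitrary: xs) auto

interpretation cubic: double_six_quadrangle cubic_graph
proof -
  interpret pair_graph cubic_graph
    by (rule pair_graph_cubic_graph)
  have in_triple: "z \<in> set L"
    if L: "L \<in> set tritangent" "x \<in> set L" "y \<in> set L" "x \<noteq> y"
      and m: "meets z x" "meets z y" for L x y z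
  proof (rule ccontr)
    assume "z \<notin> set L"
    then obtain t where t: "{u \<in> set L. meets z u} = {t}"
      using meets_one_of_triple[OF L(1)] meets_cubic_lines[OF m(1)] by blast
    have "x \<in> {u \<in> set L. meets z u}" "y \<in> {u \<in> set L. meets z u}"
      using L m by auto
    with t \<open>x \<noteq> y\<close> show False
      by simp
  qed
  show "double_six_quadrangle cubic_graph"
  proof unfold_locales
    fix x y z w
    assume "(x, y) \<in> parcs cubic_graph" "(z, x) \<in> parcs cubic_graph" "(z, y) \<in> parcs cubic_graph"
      "(w, x) \<in> parcs cubic_graph" "(w, y) \<in> parcs cubic_graph"
    then have m: "meets x y" "meets z x" "meets z y" "meets w x" "meets w y"
      by simp_all
    then obtain L where L: "L \<in> set tritangent" "x \<in> set L" "y \<in> set L" "x \<noteq> y"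
      by (auto simp: meets_def)
    have sub: "{x, y, z, w} \<subseteq> set L"
      using in_triple[OF L] L m by blast
    show "z = w"
    proof (rule ccontr)
      assume "z \<noteq> w"
      then have "card {x, y, z, w} = 4"
        using m by (auto simp: meets_def)
      with card_mono[OF _ sub] tritangentD(1)[OF L(1)] show False
        by simp
    qed
  next
    fix x y
    assume "(x, y) \<in> parcs cubic_graph"
    then obtain L where L: "L \<in> set tritangent" "x \<in> set L" "y \<in> set L" "x \<noteq> y"
      by (auto simp: meets_def)
    have "card (set L - {x, y}) = 1"
      using tritangentD(1)[OF L(1)] L by (simp add: card_Diff_subset)
    then obtain z where "set L - {x, y} = {z}"
      by (auto simp: card_1_singleton_iff)
    then have z: "set L = {x, y, z}" "z \<noteq> x" "z \<noteq> y"
      using L by auto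
    have "z \<in> set L"
      unfolding z(1) by simp
    moreover have "meets p q" if "p \<in> set L" "q \<in> set L" "p \<noteq> q" for p q
      using L(1) that unfolding meets_def by blast
    ultimately have "meets z x" "meets z y"
      using L(2,3) z(2,3) by simp_all
    moreover have "meets w x \<or> meets w y \<or> meets w z" 
      if w: "w \<in> set cubic_lines" "w \<notin> {x, y, z}" for w
    proof -
      obtain u where "{u \<in> set L. meets w u} = {u}"
        using meets_one_of_triple[OF L(1) w(1)] w(2) unfolding z(1) by blast
      then have "u \<in> set L" "meets w u"
        by blast+
      then show ?thesis
        unfolding z(1) by blast
    qed
    ultimately show "\<exists>z. (z, x) \<in> parcs cubic_graph \<and> (z, y) \<in> parcs cubic_graph \<and>
        (\<forall>w\<in>pverts cubic_graph - {x, y, z}. (w, x) \<in> parcs cubic_graph \<or>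
          (w, y) \<in> parcs cubic_graph \<or> (w, z) \<in> parcs cubic_graph)"
      by auto
  next
    fix S v
    assume S: "S \<subseteq> pverts cubic_graph" "card S = 6" "\<forall>u\<in>S. \<forall>v\<in>S. (u, v) \<notin> parcs cubic_graph"
      and v: "v \<in> S"
    then obtain ys where ys: "set ys = S" "partner_check ys"
      using all_cocliquesD[OF double_six_check, of S] by auto
    then obtain w where "w \<in> set (filter (\<lambda>w. \<not> meets v w)
        (fold (\<lambda>u. filter (meets u)) (removeAll v ys) cubic_lines))"
      using v unfolding partner_check_def list_all_iff by (metis last_in_set)
    then have "w \<in> set cubic_lines" "\<not> meets v w" "\<forall>u\<in>S - {v}. meets u w"
      using ys by (auto simp: set_fold_filter)
    then show "\<exists>w\<in>pverts cubic_graph. (w, v) \<notin> parcs cubic_graph \<and>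
        (\<forall>u\<in>S - {v}. (w, u) \<in> parcs cubic_graph)"
      using meets_sym by auto
  qed
qed

lemma cubic_graph_no_five_coloring: "\<not> proper_coloring cubic_graph 5 c"
proof (rule cubic.no_five_coloring)
  have "card (set cubic_lines) = 27"
    by (simp add: cubic_lines_def)
  then show "25 < card (pverts cubic_graph)"
    by simp
qed

section \<open>The lines skew to a given line\<close>

abbreviation clebsch_graph :: "nat pair_pre_digraph" where
  "clebsch_graph \<equiv> induced cubic_graph (cubic.far 1)"

lemma far_1: "cubic.far 1 = set [2,3,4,5,6,10,23,24,25,26,34,35,36,45,46,56]"
proof -
  have "filter (\<lambda>u. u \<noteq> 1 \<and> \<not> meets u 1) cubic_lines = [2,3,4,5,6,10,23,24,25,26,34,35,36,45,46,56]"
    by (simp only: cubic_lines_def evaluate cong: if_weak_cong)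
  moreover have "cubic.far 1 = set (filter (\<lambda>u. u \<noteq> 1 \<and> \<not> meets u 1) cubic_lines)"
    by (auto simp: cubic.far_def)
  ultimately show ?thesis
    by (simp only:)
qed

definition clebsch_coloring :: "nat \<Rightarrow> nat" where
  "clebsch_coloring u = (if u \<in> set [2,3,4,5,6] then 0 else if u \<in> set [10,23,24,25,26] then 1
     else if u \<in> set [34,35,36] then 2 else 3)"

lemma clebsch_four_coloring: "proper_coloring clebsch_graph 4 clebsch_coloring"
proof -
  have "list_all (\<lambda>u. list_all (\<lambda>v. meets u v \<longrightarrow> clebsch_coloring u \<noteq> clebsch_coloring v)
      [2,3,4,5,6,10,23,24,25,26,34,35,36,45,46,56]) [2,3,4,5,6,10,23,24,25,26,34,35,36,45,46,56]"
    by (simp only: clebsch_coloring_def evaluate zero_neq_numeral zero_neq_one zero_neq_numeral[symmetric]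
        zero_neq_one[symmetric] cong: if_weak_cong)
  then have "clebsch_coloring u \<noteq> clebsch_coloring v"
    if "u \<in> cubic.far 1" "v \<in> cubic.far 1" "meets u v" for u v
    using that unfolding far_1 list_all_iff by blast
  moreover have "clebsch_coloring u < 4" for u
    by (simp add: clebsch_coloring_def)
  ultimately show ?thesis
    by (auto simp: proper_coloring_def)
qed

lemma clebsch_no_three_coloring: "\<not> proper_coloring clebsch_graph 3 c"
proof
  assume "proper_coloring clebsch_graph 3 c"
  then have "\<exists>c. proper_coloring cubic_graph (3 + 2) c"
    by (intro cubic.extend_far_coloring[of id]) (auto simp: cubic_lines_def)
  then show False
    using cubic_graph_no_five_coloring by simp
qed

lemma cubic_six_coloring: "\<exists>c. proper_coloring cubic_graph 6 c"
proof -
  have "\<exists>c. proper_coloring cubic_graph (4 + 2) c"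
    using clebsch_four_coloring by (intro cubic.extend_far_coloring[of id]) (auto simp: cubic_lines_def)
  then show ?thesis
    by simp
qed

lemma clique_number_cubic_graph: "clique_number cubic_graph = 3"
proof (rule clique_number_eqI)
  show "is_clique cubic_graph {1, 20, 12}"
    unfolding is_clique_def by (simp add: cubic_lines_def meets_def tritangent_def)
qed (simp_all add: cubic.clique_card_le_3)

lemma clique_number_clebsch_graph: "clique_number clebsch_graph = 2"
proof (rule clique_number_eqI)
  have "meets 2 10" "meets 10 2"
    by (simp_all add: meets_def tritangent_def)
  then show "is_clique clebsch_graph {2, 10}"
    unfolding is_clique_def far_1 by simp
  show "card K \<le> 2" if "is_clique clebsch_graph K" for K
    using cubic.far_clique_card_le_2[OF _ that] by (simp add: cubic_lines_def)
qed simp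

theorem mainTheorem3:
  shows "(\<exists>G :: nat pair_pre_digraph. pair_graph G \<and> free_of {P3_union_P2, gem} G \<and>
            clique_number G = 2 \<and> chromatic_number G = 4) \<and>
         (\<exists>G :: nat pair_pre_digraph. pair_graph G \<and> free_of {P3_union_P2, gem} G \<and>
            clique_number G = 3 \<and> chromatic_number G = 6)"
proof (intro conjI)
  have far: "cubic.far 1 \<subseteq> pverts cubic_graph"
    by (auto simp: cubic.far_def)
  have "chromatic_number clebsch_graph = Suc 3"
    using clebsch_four_coloring clebsch_no_three_coloring by (intro chromatic_number_eqI) simp_all
  then show "\<exists>G :: nat pair_pre_digraph. pair_graph G \<and> free_of {P3_union_P2, gem} G \<and>
      clique_number G = 2 \<and> chromatic_number G = 4"
    using cubic.pair_graph_induced[OF far] cubic.free_of_induced[OF far] clique_number_clebsch_graph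
    by (intro exI[of _ clebsch_graph]) simp
next
  obtain c where "proper_coloring cubic_graph (Suc 5) c"
    using cubic_six_coloring by auto
  then have "chromatic_number cubic_graph = Suc 5"
    using cubic_graph_no_five_coloring by (rule chromatic_number_eqI)
  moreover have "free_of {P3_union_P2, gem} cubic_graph"
    using cubic.free_of_induced[OF subset_refl] by (simp only: cubic.induced_all)
  ultimately show "\<exists>G :: nat pair_pre_digraph. pair_graph G \<and> free_of {P3_union_P2, gem} G \<and>
      clique_number G = 3 \<and> chromatic_number G = 6"
    using pair_graph_cubic_graph clique_number_cubic_graph by (intro exI[of _ cubic_graph]) simp
qed

end
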